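(* Let $k\ge 2$, $l\ge 1$, and let $\mathcal{F}=(V,\mathcal{E})$ be a $k$-uniform hypergraph on $n=|V|$ vertices which is both an edge-minimal hypertree and an $l$-hypertree. Then $|\mathcal{E}|\le l\,\frac{n(n-1)}{2}$.
   Context: A $k$-uniform hypergraph $\mathcal{H}=(V,\mathcal{E})$ consists of a finite vertex set $V$ and a set $\mathcal{E}$ of $k$-element subsets of $V$ (no multiple edges). A $k$-uniform hypergraph is a chain if there is a sequence $v_1,\dots,v_l$ of its vertices in which every vertex appears at least once (possibly more times), $v_1\ne v_l$, and its edge set consists of exactly the $l-k+1$ distinct sets $\{v_i,\dots,v_{i+k-1}\}$, $1\le i\le l-k+1$; it is a semicycle if the same holds with $v_1=v_l$ instead. The length of a chain is its number of edges. $\mathcal{H}$ is chain-connected if every pair of distinct vertices is contained in some subhypergraph that is a chain; semicycle-free if no subhypergraph is a semicycle. A hypertree is a chain-connected, semicycle-free $k$-uniform hypergraph. An $l$-hypertree is a hypertree in which every chain (subhypergraph) has length at most $l$. An edge-minimal hypertree is a hypertree $(V,\mathcal{E})$ such that for every $e\in\mathcal{E}$, $(V,\mathcal{E}\setminus\{e\})$ is not a hypertree. *)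

theory Defs
  imports Complex_Main
begin

definition uniform_hypergraph :: "nat \<Rightarrow> 'a set \<Rightarrow> 'a set set \<Rightarrow> bool" where
  "uniform_hypergraph k V E \<longleftrightarrow> finite V \<and> (\<forall>e\<in>E. e \<subseteq> V \<and> card e = k)"

definition subhypergraph :: "'a set \<Rightarrow> 'a set set \<Rightarrow> 'a set \<Rightarrow> 'a set set \<Rightarrow> bool" where
  "subhypergraph V' E' V E \<longleftrightarrow> V' \<subseteq> V \<and> E' \<subseteq> E \<and> (\<forall>e\<in>E'. e \<subseteq> V')"

definition window :: "nat \<Rightarrow> 'a list \<Rightarrow> nat \<Rightarrow> 'a set" where
  "window k vs i = (\<lambda>j. vs ! j) ` {i..<i + k}"

(* Injectivity says that the length vs - k + 1 windows are pairwise distinct.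
   The condition k <= length vs makes this number of edges positive, which excludes
   degenerate edgeless chains and semicycles. *)
definition spanning_sequence :: "nat \<Rightarrow> 'a list \<Rightarrow> 'a set \<Rightarrow> 'a set set \<Rightarrow> bool" where
  "spanning_sequence k vs V E \<longleftrightarrow>
     k \<le> length vs \<and> set vs = V \<and>
     inj_on (window k vs) {..<length vs - k + 1} \<and>
     E = window k vs ` {..<length vs - k + 1}"

definition is_chain :: "nat \<Rightarrow> 'a set \<Rightarrow> 'a set set \<Rightarrow> bool" where
  "is_chain k V E \<longleftrightarrow> uniform_hypergraph k V E \<and>
     (\<exists>vs. spanning_sequence k vs V E \<and> hd vs \<noteq> last vs)"

definition is_semicycle :: "nat \<Rightarrow> 'a set \<Rightarrow> 'a set set \<Rightarrow> bool" where
  "is_semicycle k V E \<longleftrightarrow> uniform_hypergraph k V E \<and>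
     (\<exists>vs. spanning_sequence k vs V E \<and> hd vs = last vs)"

definition chain_connected :: "nat \<Rightarrow> 'a set \<Rightarrow> 'a set set \<Rightarrow> bool" where
  "chain_connected k V E \<longleftrightarrow>
     (\<forall>u\<in>V. \<forall>v\<in>V. u \<noteq> v \<longrightarrow>
        (\<exists>V' E'. subhypergraph V' E' V E \<and> is_chain k V' E' \<and> u \<in> V' \<and> v \<in> V'))"

definition semicycle_free :: "nat \<Rightarrow> 'a set \<Rightarrow> 'a set set \<Rightarrow> bool" where
  "semicycle_free k V E \<longleftrightarrow>
     \<not> (\<exists>V' E'. subhypergraph V' E' V E \<and> is_semicycle k V' E')"

definition hypertree :: "nat \<Rightarrow> 'a set \<Rightarrow> 'a set set \<Rightarrow> bool" where
  "hypertree k V E \<longleftrightarrow>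
     uniform_hypergraph k V E \<and> chain_connected k V E \<and> semicycle_free k V E"

definition l_hypertree :: "nat \<Rightarrow> nat \<Rightarrow> 'a set \<Rightarrow> 'a set set \<Rightarrow> bool" where
  "l_hypertree k l V E \<longleftrightarrow> hypertree k V E \<and>
     (\<forall>V' E'. subhypergraph V' E' V E \<and> is_chain k V' E' \<longrightarrow> card E' \<le> l)"

definition edge_minimal_hypertree :: "nat \<Rightarrow> 'a set \<Rightarrow> 'a set set \<Rightarrow> bool" where
  "edge_minimal_hypertree k V E \<longleftrightarrow> hypertree k V E \<and>
     (\<forall>e\<in>E. \<not> hypertree k V (E - {e}))"

end

(* Choose for every pair of vertices one chain containing it. An edge outside all chosen
   chains could be deleted without losing chain-connectedness, so by minimality the
   chosen chains, each of at most l edges, cover all the edges. *)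
theory Submission
  imports Defs
begin

lemma subhypergraph_mono:
  assumes "subhypergraph W C V E'" and "E' \<subseteq> E"
  shows "subhypergraph W C V E"
  using assms unfolding subhypergraph_def by auto

lemma semicycle_free_mono:
  assumes "semicycle_free k V E" and "E' \<subseteq> E"
  shows "semicycle_free k V E'"
  using assms unfolding semicycle_free_def by (meson subhypergraph_mono)

lemma uniform_hypergraph_mono:
  assumes "uniform_hypergraph k V E" and "E' \<subseteq> E"
  shows "uniform_hypergraph k V E'"
  using assms unfolding uniform_hypergraph_def by blast

lemma uniform_hypergraph_finite_edges:
  assumes "uniform_hypergraph k V E"
  shows "finite E"
proof (rule finite_subset)
  show "E \<subseteq> Pow V" "finite (Pow V)"
    using assms unfolding uniform_hypergraph_def by auto
qed

text \<open>The vertex set \<open>W\<close> is hidden because only the edges \<open>C\<close> are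
  counted later. Taking \<open>p\<close> as a set allows one chain to be chosen per unordered
  pair.\<close>

definition chain_through :: "nat \<Rightarrow> 'a set \<Rightarrow> 'a set set \<Rightarrow> 'a set \<Rightarrow> 'a set set \<Rightarrow> bool" where
  "chain_through k V E p C \<longleftrightarrow>
     (\<exists>W. subhypergraph W C V E \<and> is_chain k W C \<and> p \<subseteq> W)"

text \<open>Indexing by 2-subsets is what produces the factor \<open>n choose 2\<close>; a choice
  over ordered pairs of distinct vertices would double the bound. The 2-subsets of \<open>V\<close>
  are exactly the sets \<open>{u, v}\<close> with distinct \<open>u\<close>, \<open>v\<close> in
  \<open>V\<close>.\<close>

lemma chain_connected_iff:
  "chain_connected k V E \<longleftrightarrow> (\<forall>p. p \<subseteq> V \<and> card p = 2 \<longrightarrow> (\<exists>C. chain_through k V E p C))"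
proof -
  have "chain_connected k V E \<longleftrightarrow>
      (\<forall>u\<in>V. \<forall>v\<in>V. u \<noteq> v \<longrightarrow> (\<exists>C. chain_through k V E {u, v} C))"
    unfolding chain_connected_def chain_through_def insert_subset by blast
  also have "\<dots> \<longleftrightarrow> (\<forall>p. p \<subseteq> V \<and> card p = 2 \<longrightarrow> (\<exists>C. chain_through k V E p C))"
  proof (intro iffI ballI allI impI)
    fix p
    assume pairs: "\<forall>u\<in>V. \<forall>v\<in>V. u \<noteq> v \<longrightarrow> (\<exists>C. chain_through k V E {u, v} C)"
      and p: "p \<subseteq> V \<and> card p = 2"
    then obtain u v where "p = {u, v}" "u \<noteq> v"
      by (auto simp: card_2_iff)
    with pairs p show "\<exists>C. chain_through k V E p C"
      by simp
  qed simp
  finally show ?thesis .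
qed

text \<open>The ambient edge set matters only through containing \<open>C\<close>, so a chain
  survives the deletion of any edges outside it. Here \<open>E'\<close> may well be smaller than
  \<open>E\<close>.\<close>

lemma chain_through_mono:
  assumes "chain_through k V E p C" and "C \<subseteq> E'"
  shows "chain_through k V E' p C"
  using assms unfolding chain_through_def subhypergraph_def by blast

lemma edge_minimal_hypertree_covered:
  assumes minimal: "edge_minimal_hypertree k V E"
    and chains: "\<And>p. p \<subseteq> V \<Longrightarrow> card p = 2 \<Longrightarrow> chain_through k V E p (C p)"
  shows "E \<subseteq> (\<Union>p\<in>{p. p \<subseteq> V \<and> card p = 2}. C p)"
proof (rule subsetI, rule ccontr)
  fix e
  assume "e \<in> E" and uncovered: "e \<notin> (\<Union>p\<in>{p. p \<subseteq> V \<and> card p = 2}. C p)"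
  have "chain_through k V (E - {e}) p (C p)" if "p \<subseteq> V" "card p = 2" for p
  proof (rule chain_through_mono[OF chains[OF that]])
    have "C p \<subseteq> E"
      using chains[OF that] unfolding chain_through_def subhypergraph_def by blast
    then show "C p \<subseteq> E - {e}"
      using uncovered that by blast
  qed
  then have "chain_connected k V (E - {e})"
    unfolding chain_connected_iff by blast
  moreover have "hypertree k V E"
    using minimal unfolding edge_minimal_hypertree_def by blast
  \<comment> \<open>Uniformity and semicycle-freeness pass to every subset of the edges, so
    chain-connectedness is the only condition that the deletion of \<open>e\<close> could
    break.\<close>
  ultimately have "hypertree k V (E - {e})"
    unfolding hypertree_def
    by (meson Diff_subset semicycle_free_mono uniform_hypergraph_mono)
  with minimal \<open>e \<in> E\<close> show False
    unfolding edge_minimal_hypertree_def by blast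
qed

theorem theorem10:
  fixes k l n :: nat and V :: "'a set" and E :: "'a set set"
  assumes "k \<ge> 2" and "l \<ge> 1"
    and "uniform_hypergraph k V E"
    and "n = card V"
    and "edge_minimal_hypertree k V E"
    and "l_hypertree k l V E"
  shows "real (card E) \<le> real l * (real n * (real n - 1) / 2)"
proof -
  let ?P = "{p. p \<subseteq> V \<and> card p = 2}"
  have finite: "finite V"
    using assms(3) unfolding uniform_hypergraph_def by blast
  then have finite_pairs: "finite ?P"
    by simp
  have "chain_connected k V E"
    using assms(5) unfolding edge_minimal_hypertree_def hypertree_def by blast
  then obtain C where chains: "\<And>p. p \<subseteq> V \<Longrightarrow> card p = 2 \<Longrightarrow> chain_through k V E p (C p)"
    unfolding chain_connected_iff by metis
  have short: "card (C p) \<le> l" and edges: "C p \<subseteq> E" if "p \<in> ?P" for p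
    using chains[of p] that assms(6)
    unfolding chain_through_def l_hypertree_def subhypergraph_def by blast+
  \<comment> \<open>The covering yields a bound on \<open>card E\<close> only once the union is
    known to be finite, since \<open>card\<close> is 0 on infinite sets. Finiteness comes from the
    reverse inclusion, as \<open>E\<close> is a family of subsets of the finite set
    \<open>V\<close>.\<close>
  have "(\<Union>p\<in>?P. C p) \<subseteq> E"
    using edges by blast
  then have "finite (\<Union>p\<in>?P. C p)"
    using uniform_hypergraph_finite_edges[OF assms(3)] by (rule finite_subset)
  then have "card E \<le> card (\<Union>p\<in>?P. C p)"
    using edge_minimal_hypertree_covered[OF assms(5) chains] by (rule card_mono)
  also have "\<dots> \<le> (\<Sum>p\<in>?P. card (C p))"
    using finite_pairs by (rule card_UN_le)
  also have "\<dots> \<le> card ?P * l"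
    using sum_bounded_above[of ?P "\<lambda>p. card (C p)" l] short by simp
  also have "card ?P = n choose 2"
    using n_subsets[OF finite] assms(4) by simp
  finally have "real (card E) \<le> real (n choose 2) * real l"
    by (metis of_nat_le_iff of_nat_mult)
  \<comment> \<open>The generalized binomial is a falling product over the reals, which unfolds to
    two factors over 2. The subtraction is real, so the case n = 0 needs no separate
    treatment.\<close>
  also have "real (n choose 2) = real n * (real n - 1) / 2"
    by (simp add: binomial_gbinomial gbinomial_prod_rev numeral_2_eq_2)
  finally show ?thesis
    by (simp add: mult.commute)
qed

end
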